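(* A power series $\hat f\in\mathbb{C}[[x]]$ is a generic $q$-Gevrey series if, and only if, there exist $m\in\mathbb{Z}_{\ge0}$, $\{f_0,f_1,\dots,f_m\}\subset\mathbb{C}\{x\}$, $\{a_1,\dots,a_m\}\subset\mathbb{C}^*$ and $\{\alpha_1,\dots,\alpha_m\}\subset\mathbb{Z}_{\ge0}$ such that the following equality holds in $\mathbb{C}[[x]]$: $$\hat f=f_0+f_1\,\hat E_q^{(a_1,\alpha_1)}+\dots+f_m\,\hat E_q^{(a_m,\alpha_m)}.$$
   Context: $q>1$ is a fixed real number and $\sigma_q y(x)=y(qx)$. $\mathbb{C}\{x\}\subset\mathbb{C}[[x]]$ is the space of convergent power series. Generic $q$-Gevrey series: a series $\hat f\in\mathbb{C}[[x]]$ such that $\Delta\hat f\in\mathbb{C}\{x\}$ for some operator $\Delta=\sum_{k=0}^n a_{n-k}(x)(x\sigma_q)^k$ with $n\ge0$, $a_0,\dots,a_n\in\mathbb{C}\{x\}$ and $a_0(0)a_n(0)\ne0$. Generalized $q$-Euler series: $\hat E_q(x)=\sum_{n\ge0}(-1)^nq^{n(n-1)/2}x^n$; for $a\in\mathbb{C}^*$, $\hat E_q^{(a,0)}(x)=-\frac1a\hat E_q(-\frac xa)$, and for $\alpha\ge1$, $\hat E_q^{(a,\alpha)}=\frac1{\alpha!}\partial_a^\alpha\hat E_q^{(a,0)}$ (coefficientwise derivative with respect to $a$). *)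

theory Defs
  imports "HOL-Analysis.Analysis"
begin

definition convergent_fps :: "complex fps set" where
  "convergent_fps = {f. fps_conv_radius f > 0}"

definition sigma_q :: "real \<Rightarrow> complex fps \<Rightarrow> complex fps" where
  "sigma_q q y = fps_compose y (fps_const (of_real q) * fps_X)"

definition x_sigma_q :: "real \<Rightarrow> complex fps \<Rightarrow> complex fps" where
  "x_sigma_q q y = fps_X * sigma_q q y"

text \<open>The coefficient of the highest power of \<^term>\<open>x_sigma_q q\<close> is \<open>a 0\<close>, and that of the
  identity is \<open>a n\<close>.\<close>
definition q_diff_op :: "real \<Rightarrow> nat \<Rightarrow> (nat \<Rightarrow> complex fps) \<Rightarrow> complex fps \<Rightarrow> complex fps" where
  "q_diff_op q n a y = (\<Sum>k=0..n. a (n - k) * (x_sigma_q q ^^ k) y)"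

definition generic_q_Gevrey :: "real \<Rightarrow> complex fps \<Rightarrow> bool" where
  "generic_q_Gevrey q f \<longleftrightarrow>
     (\<exists>(n::nat) (a :: nat \<Rightarrow> complex fps).
        (\<forall>i\<in>{0..n}. a i \<in> convergent_fps) \<and>
        fps_nth (a 0) 0 * fps_nth (a n) 0 \<noteq> 0 \<and>
        q_diff_op q n a f \<in> convergent_fps)"

definition q_Euler :: "real \<Rightarrow> complex fps" where
  "q_Euler q = Abs_fps (\<lambda>n. (-1) ^ n * of_real q ^ (n * (n - 1) div 2))"

definition q_Euler_gen0 :: "real \<Rightarrow> complex \<Rightarrow> complex fps" where
  "q_Euler_gen0 q a = fps_const (- (1 / a)) * fps_compose (q_Euler q) (fps_const (- (1 / a)) * fps_X)"

text \<open>Only meaningful for \<open>a \<noteq> 0\<close>. There the coefficients of \<^term>\<open>q_Euler_gen0 q a\<close> are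
  holomorphic in \<open>a\<close>, so the iterated complex derivative below is the genuine one. For
  \<open>\<alpha> = 0\<close> the series is \<^term>\<open>q_Euler_gen0 q a\<close> itself.\<close>
definition q_Euler_gen :: "real \<Rightarrow> complex \<Rightarrow> nat \<Rightarrow> complex fps" where
  "q_Euler_gen q a \<alpha> =
     Abs_fps (\<lambda>n. (deriv ^^ \<alpha>) (\<lambda>b. fps_nth (q_Euler_gen0 q b) n) a / fact \<alpha>)"

end

theory Submission
  imports Defs "HOL-Computational_Algebra.Fundamental_Theorem_Algebra"
begin

text \<open>
  Let \<open>\<sigma>\<close> denote the dilation by \<open>q\<close>. Multiplication by convergent series together with \<open>x \<sigma>\<close>
  generates a noncommutative ring of operators in which the constants commute with
  \<open>x \<sigma>\<close>. The generalized q-Euler series with a fixed \<open>a\<close> form a Jordan chain for \<open>x \<sigma>\<close>: the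
  operator \<open>x \<sigma> - a\<close> maps the series of index \<open>\<alpha> + 1\<close> to the one of index \<open>\<alpha>\<close>, and the one of index
  \<open>0\<close> to \<open>1\<close> (\<open>x_sigma_q_minus_q_Euler_gen_Suc\<close>, \<open>x_sigma_q_minus_q_Euler_gen_0\<close>). Let \<open>M\<close> be the module
  over the convergent series generated by \<open>1\<close> and the generalized q-Euler series for all \<open>a \<noteq> 0\<close>
  (\<open>Euler_span\<close>). The theorem says that \<open>M\<close> is the set of generic series.

  A generic operator factors over the convergent series into units and operators \<open>x \<sigma> - c\<close> with
  \<open>c \<noteq> 0\<close>. Indeed, freeze the coefficients at \<open>0\<close> and take for \<open>c\<close> a root of maximal modulus of
  the resulting polynomial. None of the \<open>c * q ^ m\<close> with \<open>m > 0\<close> is a root, so a formal power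
  series \<open>u\<close> with constant term \<open>1\<close> can be computed such that the operator composed with \<open>u\<close> is
  divisible on the right by \<open>x \<sigma> - c\<close>. Since the lowest coefficient is a unit, \<open>c \<noteq> 0\<close>; since the
  leading one is a unit, \<open>u\<close> converges (\<open>nonresonant_root\<close>, \<open>exists_convergent_gauge\<close>,
  \<open>diff_op_right_division\<close>). Hence it suffices to know that \<open>(x \<sigma> - c) w \<in> M\<close> implies \<open>w \<in> M\<close>. As
  \<open>x \<sigma> - c\<close> is injective on all formal series, this holds as soon as every element of \<open>M\<close> has a
  preimage in \<open>M\<close> (\<open>x_sigma_q_minus_surj\<close>). A convergent right-hand side is solved by a
  convergent series up to a constant, and the constant is absorbed by a q-Euler series; the other
  generators are treated by induction along their Jordan chain, a resonance \<open>c = a * q ^ N\<close>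
  being resolved by one further step up the chain.

  Conversely, every element of \<open>M\<close> is generic. Adding generic series would call for common multiples
  of generic operators. Instead, the generators are adjoined one at a time to the module of
  convergent series, each Jordan chain from its bottom; an element involving the last generator is
  mapped into the previous module by one first-order operator, after division by a unit
  (\<open>generic_module_extend\<close>).
\<close>

section \<open>Convergent power series\<close>

text \<open>The series constructed below are given by recursions for their coefficients. Their convergence
  is therefore proved by a geometric bound and not by the radius of convergence.\<close>

lemma convergent_fps_iff_geometric_bound:
  "f \<in> convergent_fps \<longleftrightarrow> (\<exists>C R. C > 0 \<and> R > 0 \<and> (\<forall>n. norm (fps_nth f n) \<le> C * R ^ n))"
proof
  assume "f \<in> convergent_fps"
  hence "0 < fps_conv_radius f"
    by (simp add: convergent_fps_def)
  then obtain r where r: "0 < ereal r" "ereal r < fps_conv_radius f"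
    using ereal_dense2 by blast
  hence r0: "r > 0" by simp
  have "summable (\<lambda>n. fps_nth f n * complex_of_real r ^ n)"
    using r r0 by (intro summable_fps) (auto simp: eball_def)
  hence "Bseq (\<lambda>n. fps_nth f n * complex_of_real r ^ n)"
    by (intro convergent_imp_Bseq convergentI[where L = 0] summable_LIMSEQ_zero)
  then obtain K where K: "K > 0" "\<And>n. norm (fps_nth f n * complex_of_real r ^ n) \<le> K"
    by (auto simp: Bseq_def)
  have "norm (fps_nth f n) \<le> K * (1 / r) ^ n" for n
    using K(2)[of n] r0
    by (simp add: norm_mult norm_power power_one_over field_simps)
  thus "\<exists>C R. C > 0 \<and> R > 0 \<and> (\<forall>n. norm (fps_nth f n) \<le> C * R ^ n)"
    using K(1) r0 by (intro exI[of _ K] exI[of _ "1 / r"]) auto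
next
  assume "\<exists>C R. C > 0 \<and> R > 0 \<and> (\<forall>n. norm (fps_nth f n) \<le> C * R ^ n)"
  then obtain C R where CR: "C > 0" "R > 0" "\<And>n. norm (fps_nth f n) \<le> C * R ^ n"
    by blast
  \<comment> \<open>Half of the radius \<open>1 / R\<close>, so that the geometric series with quotient \<open>1 / 2\<close> dominates.\<close>
  define z where "z = complex_of_real (1 / (2 * R))"
  have "norm (fps_nth f n * z ^ n) \<le> C * (1 / 2) ^ n" for n
  proof -
    have "norm (fps_nth f n * z ^ n) = norm (fps_nth f n) * (1 / (2 * R)) ^ n"
      using CR(2) by (simp add: z_def norm_mult norm_power norm_divide)
    also have "\<dots> \<le> (C * R ^ n) * (1 / (2 * R)) ^ n"
      using CR by (intro mult_right_mono) auto
    also have "\<dots> = C * (1 / 2) ^ n"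
      using CR(2) by (simp add: power_divide power_mult_distrib)
    finally show ?thesis .
  qed
  moreover have "summable (\<lambda>n. C * (1 / 2 :: real) ^ n)"
    by (intro summable_mult summable_geometric) auto
  ultimately have "summable (\<lambda>n. fps_nth f n * z ^ n)"
    by (blast intro: summable_comparison_test')
  hence "fps_conv_radius f \<ge> norm z"
    unfolding fps_conv_radius_def by (rule conv_radius_geI)
  moreover have "ereal (norm z) > 0"
    using CR(2) by (simp add: z_def norm_divide)
  ultimately show "f \<in> convergent_fps"
    unfolding convergent_fps_def by (metis less_le_trans mem_Collect_eq)
qed

lemma convergent_fpsI:
  assumes "f \<in> convergent_fps" "K \<ge> 0" "R > 0"
    and "\<And>n. norm (fps_nth g n) \<le> K * R ^ n * norm (fps_nth f n)"
  shows "g \<in> convergent_fps"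
proof -
  obtain C S where CS: "C > 0" "S > 0" "\<And>n. norm (fps_nth f n) \<le> C * S ^ n"
    using assms(1) unfolding convergent_fps_iff_geometric_bound by blast
  have "norm (fps_nth g n) \<le> ((K + 1) * C) * (R * S) ^ n" for n
  proof -
    have "norm (fps_nth g n) \<le> K * R ^ n * norm (fps_nth f n)"
      by (rule assms(4))
    also have "\<dots> \<le> (K + 1) * R ^ n * (C * S ^ n)"
      using assms CS by (intro mult_mono) auto
    finally show ?thesis
      by (simp add: power_mult_distrib mult_ac)
  qed
  moreover have "(K + 1) * C > 0" "R * S > 0"
    using assms CS by auto
  ultimately show ?thesis
    unfolding convergent_fps_iff_geometric_bound by blast
qed

lemma convergent_fps_const [simp, intro]: "fps_const c \<in> convergent_fps"
  and convergent_fps_0 [simp, intro]: "0 \<in> convergent_fps"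
  and convergent_fps_1 [simp, intro]: "1 \<in> convergent_fps"
  and convergent_fps_X [simp, intro]: "fps_X \<in> convergent_fps"
  and convergent_fps_X_power [simp, intro]: "fps_X ^ n \<in> convergent_fps"
  by (auto simp: convergent_fps_def)

lemma convergent_fps_add [intro]:
  "f \<in> convergent_fps \<Longrightarrow> g \<in> convergent_fps \<Longrightarrow> f + g \<in> convergent_fps"
  using fps_conv_radius_add[of f g] unfolding convergent_fps_def
  by (auto simp: min_def split: if_splits)

lemma convergent_fps_mult [intro]:
  "f \<in> convergent_fps \<Longrightarrow> g \<in> convergent_fps \<Longrightarrow> f * g \<in> convergent_fps"
  using fps_conv_radius_mult[of f g] unfolding convergent_fps_def
  by (auto simp: min_def split: if_splits)

lemma convergent_fps_uminus [intro]: "f \<in> convergent_fps \<Longrightarrow> - f \<in> convergent_fps"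
  by (simp add: convergent_fps_def)

lemma convergent_fps_diff [intro]:
  "f \<in> convergent_fps \<Longrightarrow> g \<in> convergent_fps \<Longrightarrow> f - g \<in> convergent_fps"
  using convergent_fps_add[of f "- g"] by auto

lemma convergent_fps_sum [intro]:
  "(\<And>i. i \<in> I \<Longrightarrow> f i \<in> convergent_fps) \<Longrightarrow> sum f I \<in> convergent_fps"
  by (induction I rule: infinite_finite_induct) auto

lemma convergent_fps_inverse [intro]:
  "f \<in> convergent_fps \<Longrightarrow> fps_nth f 0 \<noteq> 0 \<Longrightarrow> inverse f \<in> convergent_fps"
  by (simp add: convergent_fps_def fps_conv_radius_inverse_pos)

section \<open>The q-difference operator\<close>

lemma sigma_q_nth [simp]: "fps_nth (sigma_q q y) n = of_real q ^ n * fps_nth y n"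
  by (simp add: sigma_q_def)

lemma sigma_q_funpow_nth [simp]:
  "fps_nth ((sigma_q q ^^ k) y) n = of_real q ^ (k * n) * fps_nth y n"
  by (induction k) (simp_all add: power_add)

lemma sigma_q_mult: "sigma_q q (f * g) = sigma_q q f * sigma_q q g"
  by (simp add: sigma_q_def fps_compose_mult_distrib)

lemma x_sigma_q_nth_0 [simp]: "fps_nth (x_sigma_q q y) 0 = 0"
  and x_sigma_q_nth_Suc [simp]: "fps_nth (x_sigma_q q y) (Suc n) = of_real q ^ n * fps_nth y n"
  by (simp_all add: x_sigma_q_def)

lemma x_sigma_q_mult: "x_sigma_q q (f * y) = sigma_q q f * x_sigma_q q y"
  by (simp add: x_sigma_q_def sigma_q_mult mult_ac)

lemma x_sigma_q_add: "x_sigma_q q (y + z) = x_sigma_q q y + x_sigma_q q z"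
  by (simp add: fps_eq_iff x_sigma_q_def fps_X_mult_nth algebra_simps)

lemma x_sigma_q_diff: "x_sigma_q q (y - z) = x_sigma_q q y - x_sigma_q q z"
  by (simp add: fps_eq_iff x_sigma_q_def fps_X_mult_nth algebra_simps)

lemma sigma_q_const: "sigma_q q (fps_const c) = fps_const c"
  by (simp add: fps_eq_iff)

lemma x_sigma_q_const_mult: "x_sigma_q q (fps_const c * y) = fps_const c * x_sigma_q q y"
  by (simp add: x_sigma_q_mult sigma_q_const)

lemma sigma_q_X_power: "sigma_q q (fps_X ^ k) = fps_const (of_real q ^ k) * fps_X ^ k"
  by (simp add: fps_eq_iff)

lemma x_sigma_q_funpow_diff:
  "(x_sigma_q q ^^ k) (y - z) = (x_sigma_q q ^^ k) y - (x_sigma_q q ^^ k) z"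
  by (induction k) (simp_all add: x_sigma_q_diff)

lemma x_sigma_q_funpow_const_mult:
  "(x_sigma_q q ^^ k) (fps_const c * y) = fps_const c * (x_sigma_q q ^^ k) y"
  by (induction k) (simp_all add: x_sigma_q_const_mult)

lemma x_sigma_q_funpow_mult:
  "(x_sigma_q q ^^ k) (f * y) = (sigma_q q ^^ k) f * (x_sigma_q q ^^ k) y"
  by (induction k) (simp_all add: x_sigma_q_mult)

lemma convergent_fps_sigma_q [intro]:
  assumes "q > 1" "f \<in> convergent_fps"
  shows "sigma_q q f \<in> convergent_fps"
proof (rule convergent_fpsI)
  show "norm (fps_nth (sigma_q q f) n) \<le> 1 * q ^ n * norm (fps_nth f n)" for n
    using assms(1) by (simp add: norm_mult norm_power)
qed (use assms in auto)

lemma convergent_fps_sigma_q_funpow [intro]: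
  assumes "q > 1" "f \<in> convergent_fps"
  shows "(sigma_q q ^^ k) f \<in> convergent_fps"
  by (induction k) (simp_all add: assms convergent_fps_sigma_q)

lemma convergent_fps_x_sigma_q [intro]:
  assumes "q > 1" "f \<in> convergent_fps"
  shows "x_sigma_q q f \<in> convergent_fps"
  unfolding x_sigma_q_def
  by (intro convergent_fps_mult convergent_fps_X convergent_fps_sigma_q assms)

definition x_sigma_q_minus :: "real \<Rightarrow> complex \<Rightarrow> complex fps \<Rightarrow> complex fps" where
  "x_sigma_q_minus q c y = x_sigma_q q y - fps_const c * y"

lemma x_sigma_q_minus_add:
  "x_sigma_q_minus q c (y + z) = x_sigma_q_minus q c y + x_sigma_q_minus q c z"
  unfolding x_sigma_q_minus_def x_sigma_q_add by algebra

lemma x_sigma_q_minus_diff: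
  "x_sigma_q_minus q c (y - z) = x_sigma_q_minus q c y - x_sigma_q_minus q c z"
  unfolding x_sigma_q_minus_def x_sigma_q_diff by algebra

lemma x_sigma_q_minus_const_mult:
  "x_sigma_q_minus q c (fps_const r * y) = fps_const r * x_sigma_q_minus q c y"
  unfolding x_sigma_q_minus_def x_sigma_q_const_mult by algebra

text \<open>Taking for \<open>a\<close> the eigenvalue belonging to \<open>y\<close> turns the operator on
  products \<open>h * y\<close> into a twisted first-order operator on \<open>h\<close>, up to a term in which \<open>y\<close> is
  replaced by the simpler \<open>x_sigma_q_minus q a y\<close>.\<close>

lemma x_sigma_q_minus_mult:
  "x_sigma_q_minus q c (h * y) =
    (fps_const a * sigma_q q h - fps_const c * h) * y + sigma_q q h * x_sigma_q_minus q a y"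
  unfolding x_sigma_q_minus_def x_sigma_q_mult by algebra

text \<open>Multiplication by \<open>x ^ k\<close> shifts the eigenvalue \<open>a\<close> to \<open>a * q ^ k\<close>. This is the source of all
  resonances.\<close>

lemma x_sigma_q_minus_X_power_mult:
  "x_sigma_q_minus q (a * of_real q ^ k) (fps_X ^ k * y) =
    fps_const (of_real q ^ k) * fps_X ^ k * x_sigma_q_minus q a y"
  unfolding x_sigma_q_minus_def x_sigma_q_mult sigma_q_X_power fps_const_mult[symmetric]
  by algebra

text \<open>The shift raises the order at \<open>0\<close>, so each coefficient of \<open>y\<close> is determined by the equation and
  the previous one.\<close>

lemma x_sigma_q_minus_injective:
  assumes "c \<noteq> 0" "x_sigma_q_minus q c y = x_sigma_q_minus q c z"
  shows "y = z"
proof (rule fps_ext)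
  fix n
  have *: "fps_nth (x_sigma_q q y) m - c * fps_nth y m = fps_nth (x_sigma_q q z) m - c * fps_nth z m" for m
    using arg_cong[OF assms(2), of "\<lambda>f. fps_nth f m"] by (simp add: x_sigma_q_minus_def)
  show "fps_nth y n = fps_nth z n"
  proof (induction n)
    case 0
    show ?case using *[of 0] assms(1) by simp
  next
    case (Suc n)
    show ?case using *[of "Suc n"] Suc assms(1) by simp
  qed
qed

text \<open>The coefficients are indexed by the power of the operator that they multiply, in the opposite
  order to \<^const>\<open>q_diff_op\<close>. This is the convenient order for composing and dividing.\<close>

definition diff_op :: "real \<Rightarrow> nat \<Rightarrow> (nat \<Rightarrow> complex fps) \<Rightarrow> complex fps \<Rightarrow> complex fps" where
  "diff_op q n b y = (\<Sum>k\<le>n. b k * (x_sigma_q q ^^ k) y)"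

definition nondegenerate :: "nat \<Rightarrow> (nat \<Rightarrow> complex fps) \<Rightarrow> bool" where
  "nondegenerate n b \<longleftrightarrow>
    (\<forall>k\<le>n. b k \<in> convergent_fps) \<and> fps_nth (b 0) 0 \<noteq> 0 \<and> fps_nth (b n) 0 \<noteq> 0"

lemma generic_q_Gevrey_iff:
  "generic_q_Gevrey q f \<longleftrightarrow> (\<exists>n b. nondegenerate n b \<and> diff_op q n b f \<in> convergent_fps)"
proof
  assume "generic_q_Gevrey q f"
  then obtain n a where a: "\<forall>i\<in>{0..n}. a i \<in> convergent_fps"
    "fps_nth (a 0) 0 * fps_nth (a n) 0 \<noteq> 0" "q_diff_op q n a f \<in> convergent_fps"
    unfolding generic_q_Gevrey_def by blast
  thus "\<exists>n b. nondegenerate n b \<and> diff_op q n b f \<in> convergent_fps"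
    by (intro exI[of _ n] exI[of _ "\<lambda>k. a (n - k)"])
      (auto simp: nondegenerate_def diff_op_def q_diff_op_def atLeast0AtMost)
next
  assume "\<exists>n b. nondegenerate n b \<and> diff_op q n b f \<in> convergent_fps"
  then obtain n b where b: "nondegenerate n b" "diff_op q n b f \<in> convergent_fps"
    by blast
  have "q_diff_op q n (\<lambda>k. b (n - k)) f = diff_op q n b f"
    unfolding q_diff_op_def diff_op_def by (intro sum.cong) auto
  with b show "generic_q_Gevrey q f"
    unfolding generic_q_Gevrey_def
    by (intro exI[of _ n] exI[of _ "\<lambda>k. b (n - k)"]) (auto simp: nondegenerate_def)
qed

section \<open>The q-Euler series\<close>

text \<open>The form \<open>inverse b ^ Suc n\<close> agrees with the coefficients of the q-Euler series, up to a
  factor, for every \<open>b\<close>: at \<open>b = 0\<close> both are \<open>0\<close> by the convention on division. Thus the functions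
  to be differentiated are equal, not just equal near \<open>a\<close>.\<close>

lemma higher_deriv_inverse_power:
  fixes a :: complex
  assumes "a \<noteq> 0"
  shows "(deriv ^^ \<alpha>) (\<lambda>b. K * inverse b ^ Suc n) a =
    K * (-1) ^ \<alpha> * fact \<alpha> * of_nat ((n + \<alpha>) choose \<alpha>) * inverse a ^ Suc (n + \<alpha>)"
  using assms
proof (induction \<alpha> arbitrary: a)
  case 0
  thus ?case by simp
next
  case (Suc \<alpha>)
  define L where "L = K * (-1) ^ \<alpha> * fact \<alpha> * of_nat ((n + \<alpha>) choose \<alpha>)"
  have "eventually (\<lambda>b. b \<in> - {0}) (nhds a)"
    using Suc.prems by (intro eventually_nhds_in_open) auto
  hence "eventually (\<lambda>b. (deriv ^^ \<alpha>) (\<lambda>b. K * inverse b ^ Suc n) b = L * inverse b ^ Suc (n + \<alpha>)) (nhds a)"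
    by eventually_elim (use Suc.IH in \<open>simp add: L_def\<close>)
  hence "(deriv ^^ Suc \<alpha>) (\<lambda>b. K * inverse b ^ Suc n) a = deriv (\<lambda>b. L * inverse b ^ Suc (n + \<alpha>)) a"
    unfolding funpow.simps o_def by (intro deriv_cong_ev) auto
  also have "\<dots> = L * (of_nat (Suc (n + \<alpha>)) * inverse a ^ (n + \<alpha>) * (- (inverse a ^ 2)))"
    using Suc.prems
    by (intro DERIV_imp_deriv)
      (auto intro!: derivative_eq_intros simp: power2_eq_square simp del: power_Suc of_nat_Suc)
  also have "\<dots> = - (L * of_nat (Suc (n + \<alpha>))) * inverse a ^ Suc (n + Suc \<alpha>)"
    by (simp add: power2_eq_square mult_ac del: of_nat_Suc)
  also have "L * of_nat (Suc (n + \<alpha>)) =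
      K * (-1) ^ \<alpha> * fact \<alpha> * of_nat (Suc (n + \<alpha>) * ((n + \<alpha>) choose \<alpha>))"
    by (simp only: L_def of_nat_mult mult_ac)
  also have "Suc (n + \<alpha>) * ((n + \<alpha>) choose \<alpha>) = ((n + Suc \<alpha>) choose Suc \<alpha>) * Suc \<alpha>"
    by (simp only: Suc_times_binomial_eq add_Suc_right)
  also have "- (K * (-1) ^ \<alpha> * fact \<alpha> * of_nat (N * Suc \<alpha>)) * v =
      K * (-1) ^ Suc \<alpha> * fact (Suc \<alpha>) * of_nat N * v" for N v
    by (simp add: algebra_simps)
  finally show ?case .
qed

lemma q_Euler_gen_nth:
  assumes "a \<noteq> 0"
  shows "fps_nth (q_Euler_gen q a \<alpha>) n =
    - ((-1) ^ \<alpha> * of_real q ^ (n * (n - 1) div 2) * of_nat ((n + \<alpha>) choose \<alpha>) * inverse a ^ Suc (n + \<alpha>))"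
proof -
  have "fps_nth (q_Euler_gen0 q b) n = - (of_real q ^ (n * (n - 1) div 2)) * inverse b ^ Suc n" for b
  proof -
    have "((-1) ^ n * (- (1 / b)) ^ n :: complex) = inverse b ^ n"
      by (simp add: divide_inverse flip: power_mult_distrib)
    thus ?thesis
      unfolding q_Euler_gen0_def q_Euler_def fps_mult_left_const_nth fps_nth_compose_linear
      by (simp add: divide_inverse mult_ac)
  qed
  hence "(\<lambda>b. fps_nth (q_Euler_gen0 q b) n) =
      (\<lambda>b. - (of_real q ^ (n * (n - 1) div 2)) * inverse b ^ Suc n)"
    by (rule ext)
  hence "fps_nth (q_Euler_gen q a \<alpha>) n =
      (deriv ^^ \<alpha>) (\<lambda>b. - (of_real q ^ (n * (n - 1) div 2)) * inverse b ^ Suc n) a / fact \<alpha>"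
    by (simp only: q_Euler_gen_def fps_nth_Abs_fps)
  thus ?thesis
    unfolding higher_deriv_inverse_power[OF assms] by simp
qed

lemma triangle_Suc: "Suc n * n div 2 = n + n * (n - 1) div 2"
proof (cases n)
  case (Suc m)
  have "Suc (Suc m) * Suc m = 2 * Suc m + Suc m * m" by simp
  thus ?thesis unfolding Suc by simp
qed auto

text \<open>The functional equation of the q-Euler series. Differentiating it \<open>\<alpha> + 1\<close> times in \<open>a\<close> yields
  the next lemma, which is proved from the explicit coefficients by Pascal's rule: the series
  with a fixed \<open>a\<close> form a Jordan chain that ends in \<open>1\<close>.\<close>

lemma x_sigma_q_minus_q_Euler_gen_0:
  assumes "a \<noteq> 0"
  shows "x_sigma_q_minus q a (q_Euler_gen q a 0) = 1"
proof (rule fps_ext)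
  fix n
  show "fps_nth (x_sigma_q_minus q a (q_Euler_gen q a 0)) n = fps_nth 1 n"
  proof (cases n)
    case 0
    thus ?thesis
      using assms by (simp add: x_sigma_q_minus_def q_Euler_gen_nth)
  next
    case (Suc m)
    have "Suc m * (Suc m - 1) div 2 = m + m * (m - 1) div 2"
      using triangle_Suc[of m] by simp
    thus ?thesis
      unfolding Suc using assms
      by (simp add: x_sigma_q_minus_def q_Euler_gen_nth power_add del: mult_Suc)
  qed
qed

lemma x_sigma_q_minus_q_Euler_gen_Suc:
  assumes "a \<noteq> 0"
  shows "x_sigma_q_minus q a (q_Euler_gen q a (Suc \<alpha>)) = q_Euler_gen q a \<alpha>"
proof (rule fps_ext)
  fix n
  show "fps_nth (x_sigma_q_minus q a (q_Euler_gen q a (Suc \<alpha>))) n = fps_nth (q_Euler_gen q a \<alpha>) n"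
  proof (cases n)
    case 0
    thus ?thesis
      using assms by (simp add: x_sigma_q_minus_def q_Euler_gen_nth)
  next
    case (Suc m)
    define t :: complex where "t = of_real q ^ (m * (m - 1) div 2)"
    define A :: complex where "A = of_nat ((m + Suc \<alpha>) choose Suc \<alpha>)"
    define B :: complex where "B = of_nat ((Suc m + \<alpha>) choose \<alpha>)"
    define v where "v = inverse a ^ Suc (m + Suc \<alpha>)"
    have t: "of_real q ^ (Suc m * (Suc m - 1) div 2) = of_real q ^ m * t"
      using triangle_Suc[of m] by (simp add: t_def power_add del: mult_Suc)
    have AB: "of_nat ((Suc m + Suc \<alpha>) choose Suc \<alpha>) = A + B"
      by (simp add: A_def B_def)
    have 1: "fps_nth (q_Euler_gen q a (Suc \<alpha>)) m = - ((-1) ^ Suc \<alpha> * t * A * v)"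
      unfolding q_Euler_gen_nth[OF assms] t_def A_def v_def ..
    have 2: "fps_nth (q_Euler_gen q a (Suc \<alpha>)) (Suc m) =
        - ((-1) ^ Suc \<alpha> * (of_real q ^ m * t) * (A + B) * (v * inverse a))"
      unfolding q_Euler_gen_nth[OF assms] t AB v_def by simp
    have 3: "fps_nth (q_Euler_gen q a \<alpha>) (Suc m) = - ((-1) ^ \<alpha> * (of_real q ^ m * t) * B * v)"
      unfolding q_Euler_gen_nth[OF assms] t B_def v_def by simp
    have "a * (v * inverse a) = v"
      using assms by simp
    hence "a * (- ((-1) ^ Suc \<alpha> * (of_real q ^ m * t) * (A + B) * (v * inverse a))) =
        - ((-1) ^ Suc \<alpha> * (of_real q ^ m * t) * (A + B) * v)"
      by (metis mult.left_commute mult_minus_right)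
    thus ?thesis
      unfolding Suc x_sigma_q_minus_def fps_sub_nth fps_mult_left_const_nth x_sigma_q_nth_Suc 1 2 3
      by (simp add: algebra_simps)
  qed
qed

section \<open>Inverting a first-order operator\<close>

text \<open>The module over the convergent series that is generated by \<open>1\<close> and the generalized q-Euler
  series. In contrast to the explicit sum with \<open>m\<close> terms, the inductive form avoids
  reindexing in the closure properties.\<close>

inductive_set Euler_span :: "real \<Rightarrow> complex fps set" for q :: real where
  convergent: "f \<in> convergent_fps \<Longrightarrow> f \<in> Euler_span q"
| add_Euler: "y \<in> Euler_span q \<Longrightarrow> f \<in> convergent_fps \<Longrightarrow> a \<noteq> 0 \<Longrightarrow>
    y + f * q_Euler_gen q a \<alpha> \<in> Euler_span q"

lemma Euler_span_add:
  assumes "y \<in> Euler_span q" "z \<in> Euler_span q"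
  shows "y + z \<in> Euler_span q"
  using assms(2,1)
proof (induction z)
  case (convergent f)
  from convergent(2) show ?case
  proof (induction y)
    case (convergent g)
    thus ?case using \<open>f \<in> convergent_fps\<close> by (intro Euler_span.convergent) auto
  next
    case (add_Euler y g a \<alpha>)
    hence "(y + f) + g * q_Euler_gen q a \<alpha> \<in> Euler_span q"
      by (intro Euler_span.add_Euler) auto
    thus ?case by (simp add: add_ac)
  qed
next
  case (add_Euler z g a \<alpha>)
  hence "(y + z) + g * q_Euler_gen q a \<alpha> \<in> Euler_span q"
    by (intro Euler_span.add_Euler) auto
  thus ?case by (simp add: add_ac)
qed

lemma Euler_span_mult:
  assumes "f \<in> convergent_fps" "y \<in> Euler_span q"
  shows "f * y \<in> Euler_span q"
  using assms(2)
proof induction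
  case (convergent g)
  thus ?case using assms(1) by (intro Euler_span.convergent) auto
next
  case (add_Euler y g a \<alpha>)
  hence "f * y + (f * g) * q_Euler_gen q a \<alpha> \<in> Euler_span q"
    using assms(1) by (intro Euler_span.add_Euler) auto
  thus ?case by (simp add: algebra_simps)
qed

lemma Euler_span_q_Euler_gen:
  assumes "f \<in> convergent_fps" "a \<noteq> 0"
  shows "f * q_Euler_gen q a \<alpha> \<in> Euler_span q"
  using Euler_span.add_Euler[OF Euler_span.convergent[OF convergent_fps_0] assms, where q = q and \<alpha> = \<alpha>] by simp

lemma Euler_span_diff:
  assumes "y \<in> Euler_span q" "z \<in> Euler_span q"
  shows "y - z \<in> Euler_span q"
  using Euler_span_add[OF assms(1) Euler_span_mult[OF convergent_fps_const[of "-1"] assms(2)]]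
  by (simp flip: fps_const_neg)

lemma Euler_span_iff:
  "y \<in> Euler_span q \<longleftrightarrow>
    (\<exists>(m::nat) (f :: nat \<Rightarrow> complex fps) (a :: nat \<Rightarrow> complex) (\<alpha> :: nat \<Rightarrow> nat).
       (\<forall>i\<in>{0..m}. f i \<in> convergent_fps) \<and>
       (\<forall>i\<in>{1..m}. a i \<noteq> 0) \<and>
       y = f 0 + (\<Sum>i=1..m. f i * q_Euler_gen q (a i) (\<alpha> i)))"
proof
  assume "y \<in> Euler_span q"
  thus "\<exists>(m::nat) (f :: nat \<Rightarrow> complex fps) (a :: nat \<Rightarrow> complex) (\<alpha> :: nat \<Rightarrow> nat).
       (\<forall>i\<in>{0..m}. f i \<in> convergent_fps) \<and> (\<forall>i\<in>{1..m}. a i \<noteq> 0) \<and>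
       y = f 0 + (\<Sum>i=1..m. f i * q_Euler_gen q (a i) (\<alpha> i))"
  proof induction
    case (convergent f)
    thus ?case by (intro exI[of _ 0] exI[of _ "\<lambda>_. f"]) auto
  next
    case (add_Euler y g b \<beta>)
    then obtain m and f :: "nat \<Rightarrow> complex fps" and a :: "nat \<Rightarrow> complex" and \<alpha> :: "nat \<Rightarrow> nat" where *: "\<forall>i\<in>{0..m}. f i \<in> convergent_fps" "\<forall>i\<in>{1..m}. a i \<noteq> 0"
      "y = f 0 + (\<Sum>i=1..m. f i * q_Euler_gen q (a i) (\<alpha> i))" by blast
    have "(\<Sum>i=1..m. (f(Suc m := g)) i * q_Euler_gen q ((a(Suc m := b)) i) ((\<alpha>(Suc m := \<beta>)) i)) =
        (\<Sum>i=1..m. f i * q_Euler_gen q (a i) (\<alpha> i))"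
      by (intro sum.cong) auto
    thus ?case
      using * add_Euler.hyps
      by (intro exI[of _ "Suc m"] exI[of _ "f(Suc m := g)"] exI[of _ "a(Suc m := b)"]
            exI[of _ "\<alpha>(Suc m := \<beta>)"]) (auto simp: add_ac)
  qed
next
  assume "\<exists>(m::nat) (f :: nat \<Rightarrow> complex fps) (a :: nat \<Rightarrow> complex) (\<alpha> :: nat \<Rightarrow> nat).
       (\<forall>i\<in>{0..m}. f i \<in> convergent_fps) \<and> (\<forall>i\<in>{1..m}. a i \<noteq> 0) \<and>
       y = f 0 + (\<Sum>i=1..m. f i * q_Euler_gen q (a i) (\<alpha> i))"
  then obtain m and f :: "nat \<Rightarrow> complex fps" and a :: "nat \<Rightarrow> complex" and \<alpha> :: "nat \<Rightarrow> nat"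
    where *: "\<forall>i\<in>{0..m}. f i \<in> convergent_fps" "\<forall>i\<in>{1..m}. a i \<noteq> 0"
      and y: "y = f 0 + (\<Sum>i=1..m. f i * q_Euler_gen q (a i) (\<alpha> i))" by blast
  have "f 0 + (\<Sum>i=1..k. f i * q_Euler_gen q (a i) (\<alpha> i)) \<in> Euler_span q" if "k \<le> m" for k
    using that
  proof (induction k)
    case 0
    thus ?case using *(1) by (auto intro: Euler_span.convergent)
  next
    case (Suc k)
    hence "(f 0 + (\<Sum>i=1..k. f i * q_Euler_gen q (a i) (\<alpha> i))) +
        f (Suc k) * q_Euler_gen q (a (Suc k)) (\<alpha> (Suc k)) \<in> Euler_span q"
      using * by (intro Euler_span.add_Euler) auto
    thus ?case by (simp add: add_ac)
  qed
  thus "y \<in> Euler_span q" using y by blast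
qed

lemma q_power_unbounded:
  assumes "q > (1 :: real)"
  shows "filterlim (\<lambda>n. q ^ n) at_top sequentially"
  using assms
  by (intro filterlim_at_infinity_imp_filterlim_at_top filterlim_realpow_sequentially_gt1) auto

text \<open>The denominators grow faster than any geometric sequence: the quotients of consecutive terms
  tend to \<open>0\<close>.\<close>

lemma summable_q_gaussian:
  fixes r :: real
  assumes "q > 1" "r \<ge> 0"
  shows "summable (\<lambda>j. r ^ j / q ^ (j * (j + 1) div 2))"
proof -
  have "eventually (\<lambda>j. q ^ j \<ge> 2 * r) sequentially"
    using q_power_unbounded[OF assms(1)] by (auto simp: filterlim_at_top)
  then obtain N where N: "\<And>j. j \<ge> N \<Longrightarrow> q ^ j \<ge> 2 * r"
    by (auto simp: eventually_sequentially)
  show ?thesis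
  proof (rule summable_ratio_test)
    fix j assume j: "j \<ge> N"
    have "Suc j * (Suc j + 1) div 2 = Suc j + j * (j + 1) div 2"
      using triangle_Suc[of "Suc j"] by (simp add: mult_ac)
    hence "r ^ Suc j / q ^ (Suc j * (Suc j + 1) div 2) = (r / q ^ Suc j) * (r ^ j / q ^ (j * (j + 1) div 2))"
      by (simp add: power_add del: mult_Suc)
    moreover have "r / q ^ Suc j \<le> 1 / 2"
      using N[of "Suc j"] j assms by (simp add: field_simps)
    moreover have "r ^ j / q ^ (j * (j + 1) div 2) \<ge> 0"
      using assms by simp
    ultimately have "r ^ Suc j / q ^ (Suc j * (Suc j + 1) div 2) \<le> 1 / 2 * (r ^ j / q ^ (j * (j + 1) div 2))"
      by (metis mult_right_mono)
    thus "norm (r ^ Suc j / q ^ (Suc j * (Suc j + 1) div 2)) \<le> 1 / 2 * norm (r ^ j / q ^ (j * (j + 1) div 2))"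
      using assms by (simp del: mult_Suc power_Suc)
  qed simp
qed

text \<open>The recursion \<open>q ^ n * y\<^sub>n = g\<^sub>n\<^sub>+\<^sub>1 + c * y\<^sub>n\<^sub>+\<^sub>1\<close>, which expresses the equation in positive
  degrees, is unstable upwards but strongly contracting downwards. Solving it from infinity
  gives a solution whose coefficients are the series \<open>s n\<close> below and which converges. The price
  is the equation in degree \<open>0\<close>, which can no longer be imposed: it fails by a constant.\<close>

lemma x_sigma_q_minus_solve_modulo_constant:
  assumes "q > 1" "g \<in> convergent_fps"
  obtains y r where "y \<in> convergent_fps" "x_sigma_q_minus q c y = g - fps_const r"
proof -
  obtain C R where CR: "C > 0" "R > 0" "\<And>n. norm (fps_nth g n) \<le> C * R ^ n"
    using assms(2) unfolding convergent_fps_iff_geometric_bound by blast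
  \<comment> \<open>The sum \<open>n + (n + 1) + \<dots> + (n + j)\<close>, from unrolling the recursion \<open>j\<close> times.\<close>
  define e where "e n j = n * Suc j + j * (j + 1) div 2" for n j :: nat
  define s where "s n j = fps_nth g (n + Suc j) * c ^ j / complex_of_real q ^ e n j" for n j
  define G where "G j = (R * norm c) ^ j / q ^ (j * (j + 1) div 2)" for j
  have sG: "summable G"
    unfolding G_def using assms CR by (intro summable_q_gaussian) auto
  have bound: "norm (s n j) \<le> C * R ^ Suc n * G j" for n j
  proof -
    have "norm (s n j) = norm (fps_nth g (n + Suc j)) * norm c ^ j / q ^ e n j"
      using assms(1) by (simp add: s_def norm_mult norm_divide norm_power)
    also have "\<dots> \<le> (C * R ^ (n + Suc j)) * norm c ^ j / q ^ (j * (j + 1) div 2)"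
      using assms(1) CR
      by (intro frac_le mult_right_mono CR(3)) (auto simp: e_def intro!: power_increasing)
    also have "\<dots> = C * R ^ Suc n * G j"
      by (simp add: G_def power_add power_mult_distrib)
    finally show ?thesis .
  qed
  have ss: "summable (s n)" for n
    by (rule summable_comparison_test'[OF summable_mult[OF sG] bound])
  define y where "y = Abs_fps (\<lambda>n. \<Sum>j. s n j)"
  have "norm (fps_nth y n) \<le> (C * R * (suminf G + 1)) * R ^ n" for n
  proof -
    have "norm (fps_nth y n) \<le> (\<Sum>j. C * R ^ Suc n * G j)"
      unfolding y_def fps_nth_Abs_fps
      by (rule norm_suminf_le[OF bound summable_mult[OF sG]])
    also have "\<dots> = (C * R * suminf G) * R ^ n"
      using suminf_mult[OF sG] by simp
    also have "\<dots> \<le> (C * R * (suminf G + 1)) * R ^ n"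
      using CR by (intro mult_right_mono mult_left_mono) auto
    finally show ?thesis .
  qed
  moreover have "C * R * (suminf G + 1) > 0"
  proof -
    have "suminf G \<ge> 0"
      using assms(1) CR by (intro suminf_nonneg[OF sG]) (auto simp: G_def)
    thus ?thesis using CR by simp
  qed
  ultimately have y: "y \<in> convergent_fps"
    unfolding convergent_fps_iff_geometric_bound using CR(2) by blast
  have rec: "of_real q ^ n * fps_nth y n = fps_nth g (Suc n) + c * fps_nth y (Suc n)" for n
  proof -
    have 0: "s n 0 * of_real q ^ n = fps_nth g (Suc n)"
      using assms(1) by (simp add: s_def e_def)
    have Suc: "of_real q ^ n * s n (Suc j) = c * s (Suc n) j" for j
    proof -
      have "Suc j * (Suc j + 1) div 2 = Suc j + j * (j + 1) div 2"
        using triangle_Suc[of "Suc j"] by (simp add: mult_ac)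
      hence "e n (Suc j) = n + e (Suc n) j"
        by (simp add: e_def)
      thus ?thesis
        using assms(1) by (simp add: s_def power_add)
    qed
    have "of_real q ^ n * fps_nth y n = of_real q ^ n * (s n 0 + (\<Sum>j. s n (Suc j)))"
      using suminf_split_head[OF ss, of n] by (simp add: y_def)
    also have "\<dots> = fps_nth g (Suc n) + of_real q ^ n * (\<Sum>j. s n (Suc j))"
      using 0 by (simp add: algebra_simps)
    also have "of_real q ^ n * (\<Sum>j. s n (Suc j)) = (\<Sum>j. of_real q ^ n * s n (Suc j))"
      using ss by (intro suminf_mult [symmetric]) (simp add: summable_Suc_iff)
    also have "\<dots> = c * fps_nth y (Suc n)"
      unfolding Suc y_def fps_nth_Abs_fps using ss by (intro suminf_mult)
    finally show ?thesis .
  qed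
  have "x_sigma_q_minus q c y = g - fps_const (fps_nth g 0 + c * fps_nth y 0)"
  proof (rule fps_ext)
    fix n
    show "fps_nth (x_sigma_q_minus q c y) n = fps_nth (g - fps_const (fps_nth g 0 + c * fps_nth y 0)) n"
      using rec by (cases n) (simp_all add: x_sigma_q_minus_def)
  qed
  with y show thesis by (rule that)
qed

text \<open>The constant that the convergent solution misses is supplied by a multiple of the q-Euler
  series, on which the operator takes the value \<open>1\<close>.\<close>

lemma x_sigma_q_minus_surj_convergent:
  assumes "q > 1" "c \<noteq> 0" "g \<in> convergent_fps"
  shows "\<exists>y\<in>Euler_span q. x_sigma_q_minus q c y = g"
proof -
  obtain y r where y: "y \<in> convergent_fps" "x_sigma_q_minus q c y = g - fps_const r"
    using x_sigma_q_minus_solve_modulo_constant[OF assms(1,3)] by blast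
  have "x_sigma_q_minus q c (y + fps_const r * q_Euler_gen q c 0) = g"
    using assms(2) y(2)
    by (simp add: x_sigma_q_minus_add x_sigma_q_minus_const_mult x_sigma_q_minus_q_Euler_gen_0)
  moreover have "y + fps_const r * q_Euler_gen q c 0 \<in> Euler_span q"
    using assms(2) y(1) by (intro Euler_span.intros) auto
  ultimately show ?thesis by blast
qed

text \<open>In degree \<open>n\<close> the equation for \<open>h\<close> reads \<open>(a * q ^ n - c) * h\<^sub>n = f\<^sub>n\<close>. The factor tends to
  infinity, so dividing by it preserves convergence, and it vanishes for one \<open>n\<close> at most. The
  remainder \<open>p\<close> collects that resonant monomial.\<close>

lemma q_twisted_division:
  assumes "q > 1" "a \<noteq> 0" "f \<in> convergent_fps"
  obtains h p where "h \<in> convergent_fps"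
    "f = fps_const a * sigma_q q h - fps_const c * h + p"
    "p = 0 \<or> (\<exists>N r. c = a * of_real q ^ N \<and> p = fps_const r * fps_X ^ N)"
proof -
  \<comment> \<open>At a resonance the divisor is \<open>0\<close> and the quotient is \<open>0\<close> by convention, as desired.\<close>
  define h where "h = Abs_fps (\<lambda>n. fps_nth f n / (a * of_real q ^ n - c))"
  have "filterlim (\<lambda>n. norm a * q ^ n) at_top sequentially"
    using assms(2) q_power_unbounded[OF assms(1)]
    by (intro filterlim_tendsto_pos_mult_at_top[OF tendsto_const]) auto
  hence "filterlim (\<lambda>n. a * of_real q ^ n) at_infinity sequentially"
    using assms(1) by (intro filterlim_norm_at_top_imp_at_infinity) (simp add: norm_mult norm_power)
  hence "filterlim (\<lambda>n. a * of_real q ^ n + (- c)) at_infinity sequentially"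
    by (intro tendsto_add_filterlim_at_infinity'[OF _ tendsto_const])
  hence "(\<lambda>n. inverse (a * of_real q ^ n - c)) \<longlonglongrightarrow> 0"
    using tendsto_inverse_0 filterlim_compose by fastforce
  hence "Bseq (\<lambda>n. inverse (a * of_real q ^ n - c))"
    by (intro convergent_imp_Bseq convergentI)
  then obtain K where K: "K > 0" "\<And>n. norm (inverse (a * of_real q ^ n - c)) \<le> K"
    by (auto simp: Bseq_def)
  have "h \<in> convergent_fps"
  proof (rule convergent_fpsI[OF assms(3)])
    show "norm (fps_nth h n) \<le> K * 1 ^ n * norm (fps_nth f n)" for n
      using mult_right_mono[OF K(2)[of n], of "norm (fps_nth f n)"]
      by (simp add: h_def divide_inverse norm_mult mult_ac)
  qed (use K in auto)
  define p where "p = f - (fps_const a * sigma_q q h - fps_const c * h)"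
  have p_nth: "fps_nth p n = (if c = a * of_real q ^ n then fps_nth f n else 0)" for n
    by (auto simp: p_def h_def field_simps)
  have "p = 0 \<or> (\<exists>N r. c = a * of_real q ^ N \<and> p = fps_const r * fps_X ^ N)"
  proof (cases "\<exists>N. c = a * of_real q ^ N")
    case True
    then obtain N where N: "c = a * of_real q ^ N" by blast
    have "c = a * of_real q ^ n \<longleftrightarrow> n = N" for n
    proof -
      have "c = a * of_real q ^ n \<longleftrightarrow> complex_of_real (q ^ N) = complex_of_real (q ^ n)"
        using assms(2) by (simp add: N)
      thus ?thesis
        unfolding of_real_eq_iff using assms(1) by auto
    qed
    hence "p = fps_const (fps_nth f N) * fps_X ^ N"
      by (simp add: fps_eq_iff p_nth)
    with N show ?thesis by blast
  next
    case False
    hence "p = 0" by (auto simp: fps_eq_iff p_nth)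
    thus ?thesis ..
  qed
  with \<open>h \<in> convergent_fps\<close> show thesis
    by (intro that[of h p]) (simp_all add: p_def)
qed

text \<open>A preimage of \<open>f * E\<close> is sought in the form \<open>h * E\<close>, where \<open>h\<close> is obtained from \<open>f\<close> by
  division with remainder. The error involves only the predecessor of \<open>E\<close> in its Jordan chain, which is handled by
  induction. A resonant monomial \<open>x ^ N\<close> is reached by passing to the successor in the chain:
  if \<open>c = a * q ^ N\<close>, the operator maps \<open>x ^ N\<close> times the successor of \<open>E\<close> to
  \<open>q ^ N * x ^ N * E\<close>. This is why the derivatives with respect to \<open>a\<close> are needed.\<close>

lemma x_sigma_q_minus_surj_q_Euler_gen:
  assumes "q > 1" "c \<noteq> 0" "a \<noteq> 0" "f \<in> convergent_fps"
  shows "\<exists>y\<in>Euler_span q. x_sigma_q_minus q c y = f * q_Euler_gen q a \<alpha>"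
proof -
  have step: "\<exists>y\<in>Euler_span q. x_sigma_q_minus q c y = f * q_Euler_gen q a \<alpha>"
    if f: "f \<in> convergent_fps"
      and lower: "\<And>g. g \<in> convergent_fps \<Longrightarrow>
        \<exists>y\<in>Euler_span q. x_sigma_q_minus q c y = g * x_sigma_q_minus q a (q_Euler_gen q a \<alpha>)"
    for f \<alpha>
  proof -
    define E where "E = q_Euler_gen q a \<alpha>"
    obtain h p where h: "h \<in> convergent_fps"
      and f_eq: "f = fps_const a * sigma_q q h - fps_const c * h + p"
      and p: "p = 0 \<or> (\<exists>N r. c = a * of_real q ^ N \<and> p = fps_const r * fps_X ^ N)"
      using q_twisted_division[OF assms(1,3) f, where c = c] by blast
    obtain z where z: "z \<in> Euler_span q"
      "x_sigma_q_minus q c z = sigma_q q h * x_sigma_q_minus q a E"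
      using lower[of "sigma_q q h"] convergent_fps_sigma_q[OF assms(1) h] by (auto simp: E_def)
    have "\<exists>w\<in>Euler_span q. x_sigma_q_minus q c w = p * E"
      using p
    proof (elim disjE exE conjE)
      assume "p = 0"
      thus ?thesis
        by (intro bexI[of _ 0] Euler_span.convergent) (auto simp: x_sigma_q_minus_def x_sigma_q_def sigma_q_def)
    next
      fix N r assume N: "c = a * of_real q ^ N" "p = fps_const r * fps_X ^ N"
      define w where "w = fps_const (r / of_real q ^ N) * (fps_X ^ N * q_Euler_gen q a (Suc \<alpha>))"
      have "x_sigma_q_minus q c w =
          fps_const (r / of_real q ^ N) * (fps_const (of_real q ^ N) * fps_X ^ N * E)"
        unfolding w_def N(1) x_sigma_q_minus_const_mult x_sigma_q_minus_X_power_mult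
          x_sigma_q_minus_q_Euler_gen_Suc[OF assms(3)] E_def ..
      also have "\<dots> = fps_const (r / of_real q ^ N * of_real q ^ N) * fps_X ^ N * E"
        by (simp only: mult.assoc fps_const_mult[symmetric])
      also have "r / of_real q ^ N * complex_of_real q ^ N = r"
        using assms(1) by simp
      finally have "x_sigma_q_minus q c w = p * E"
        unfolding N(2) .
      moreover have "w \<in> Euler_span q"
        unfolding w_def
        by (rule Euler_span_mult[OF convergent_fps_const Euler_span_q_Euler_gen[OF convergent_fps_X_power assms(3)]])
      ultimately show ?thesis by blast
    qed
    then obtain w where w: "w \<in> Euler_span q" "x_sigma_q_minus q c w = p * E" by blast
    have "x_sigma_q_minus q c (h * E - z + w) = f * E"
      unfolding x_sigma_q_minus_add x_sigma_q_minus_diff z w f_eq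
        x_sigma_q_minus_mult[of q c h E a] by algebra
    moreover have "h * E - z + w \<in> Euler_span q"
      unfolding E_def
      by (rule Euler_span_add[OF Euler_span_diff[OF Euler_span_q_Euler_gen[OF h assms(3)] z(1)] w(1)])
    ultimately show ?thesis
      unfolding E_def by blast
  qed
  show ?thesis
    using assms(4)
  proof (induction \<alpha> arbitrary: f)
    case (0 f)
    show ?case
    proof (rule step[OF 0])
      fix g :: "complex fps" assume "g \<in> convergent_fps"
      thus "\<exists>y\<in>Euler_span q. x_sigma_q_minus q c y = g * x_sigma_q_minus q a (q_Euler_gen q a 0)"
        unfolding x_sigma_q_minus_q_Euler_gen_0[OF assms(3)] mult_1_right
        by (rule x_sigma_q_minus_surj_convergent[OF assms(1,2)])
    qed
  next
    case (Suc \<alpha> f)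
    show ?case
    proof (rule step[OF Suc.prems])
      fix g :: "complex fps" assume "g \<in> convergent_fps"
      thus "\<exists>y\<in>Euler_span q. x_sigma_q_minus q c y = g * x_sigma_q_minus q a (q_Euler_gen q a (Suc \<alpha>))"
        unfolding x_sigma_q_minus_q_Euler_gen_Suc[OF assms(3)] by (rule Suc.IH)
    qed
  qed
qed

lemma x_sigma_q_minus_surj:
  assumes "q > 1" "c \<noteq> 0" "g \<in> Euler_span q"
  shows "\<exists>y\<in>Euler_span q. x_sigma_q_minus q c y = g"
  using assms(3)
proof induction
  case (convergent f)
  with assms show ?case by (intro x_sigma_q_minus_surj_convergent)
next
  case (add_Euler g f a \<alpha>)
  then obtain y z where "y \<in> Euler_span q" "x_sigma_q_minus q c y = g"
    "z \<in> Euler_span q" "x_sigma_q_minus q c z = f * q_Euler_gen q a \<alpha>"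
    using x_sigma_q_minus_surj_q_Euler_gen[OF assms(1,2)] by blast
  thus ?case
    by (intro bexI[of _ "y + z"]) (simp_all add: x_sigma_q_minus_add Euler_span_add)
qed

lemma Euler_span_if_x_sigma_q_minus:
  assumes "q > 1" "c \<noteq> 0" "x_sigma_q_minus q c w \<in> Euler_span q"
  shows "w \<in> Euler_span q"
  using x_sigma_q_minus_surj[OF assms] x_sigma_q_minus_injective[OF assms(2)] by blast

section \<open>Series of the span are generic\<close>

lemma generic_q_Gevrey_convergent:
  assumes "f \<in> convergent_fps"
  shows "generic_q_Gevrey q f"
  unfolding generic_q_Gevrey_iff using assms
  by (intro exI[of _ 0] exI[of _ "\<lambda>_. 1"]) (simp add: nondegenerate_def diff_op_def)

text \<open>Composing a generic operator with a first-order operator and with multiplication by a unit gives a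
  generic operator again: its extreme coefficients at \<open>0\<close> are, up to nonzero constants, those of
  the given one.\<close>

lemma generic_q_Gevrey_if_x_sigma_q_minus:
  assumes "q > 1" "c \<noteq> 0" "v \<in> convergent_fps" "fps_nth v 0 \<noteq> 0"
    and "generic_q_Gevrey q (x_sigma_q_minus q c (v * z))"
  shows "generic_q_Gevrey q z"
proof -
  obtain n b where b: "nondegenerate n b" "diff_op q n b (x_sigma_q_minus q c (v * z)) \<in> convergent_fps"
    using assms(5) unfolding generic_q_Gevrey_iff by blast
  define T where "T k = (x_sigma_q q ^^ k) z" for k
  define V where "V k = (sigma_q q ^^ k) v" for k
  \<comment> \<open>The coefficients of the composition with \<open>(x \<sigma> - c) v\<close>.\<close>
  define d where "d k = ((if k = 0 then 0 else b (k - 1)) - (if k = Suc n then 0 else fps_const c * b k)) * V k" for k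
  have V: "V k \<in> convergent_fps" "fps_nth (V k) 0 = fps_nth v 0" for k
    using assms by (auto simp: V_def)
  have "diff_op q n b (x_sigma_q_minus q c (v * z)) =
      (\<Sum>k\<le>n. b k * (V (Suc k) * T (Suc k))) - (\<Sum>k\<le>n. fps_const c * b k * (V k * T k))"
    unfolding diff_op_def sum_subtractf[symmetric]
  proof (rule sum.cong[OF refl])
    fix k
    have "(x_sigma_q q ^^ k) (x_sigma_q_minus q c (v * z)) =
        (x_sigma_q q ^^ Suc k) (v * z) - fps_const c * (x_sigma_q q ^^ k) (v * z)"
      unfolding x_sigma_q_minus_def x_sigma_q_funpow_diff x_sigma_q_funpow_const_mult
        funpow_Suc_right o_apply ..
    also have "\<dots> = V (Suc k) * T (Suc k) - fps_const c * (V k * T k)"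
      unfolding x_sigma_q_funpow_mult T_def V_def ..
    finally show "b k * (x_sigma_q q ^^ k) (x_sigma_q_minus q c (v * z)) =
        b k * (V (Suc k) * T (Suc k)) - fps_const c * b k * (V k * T k)"
      by (simp only: right_diff_distrib mult_ac)
  qed
  also have "(\<Sum>k\<le>n. b k * (V (Suc k) * T (Suc k))) =
      (\<Sum>k\<le>Suc n. (if k = 0 then 0 else b (k - 1)) * V k * T k)"
    unfolding sum.atMost_Suc_shift by (simp add: mult_ac)
  also have "(\<Sum>k\<le>n. fps_const c * b k * (V k * T k)) =
      (\<Sum>k\<le>Suc n. (if k = Suc n then 0 else fps_const c * b k) * V k * T k)"
    by (simp add: mult_ac)
  also have "(\<Sum>k\<le>Suc n. (if k = 0 then 0 else b (k - 1)) * V k * T k) - \<dots> = diff_op q (Suc n) d z"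
    unfolding diff_op_def sum_subtractf[symmetric] d_def T_def left_diff_distrib ..
  finally have "diff_op q (Suc n) d z \<in> convergent_fps"
    using b(2) by simp
  moreover have "nondegenerate (Suc n) d"
    unfolding nondegenerate_def
  proof (intro conjI allI impI)
    fix k assume "k \<le> Suc n"
    thus "d k \<in> convergent_fps"
      using b(1) V unfolding d_def nondegenerate_def
      by (intro convergent_fps_mult convergent_fps_diff) auto
  qed (use b(1) V assms in \<open>auto simp: d_def nondegenerate_def\<close>)
  ultimately show ?thesis
    unfolding generic_q_Gevrey_iff by blast
qed

text \<open>Closure of the generic series under addition is hard to see directly, because it would require
  common left multiples of operators that are again generic. It is therefore replaced by modules
  all of whose elements are generic; these are enlarged one generator at a time.\<close>

definition generic_module :: "real \<Rightarrow> complex fps set \<Rightarrow> bool" where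
  "generic_module q V \<longleftrightarrow> convergent_fps \<subseteq> V \<and>
     (\<forall>y\<in>V. \<forall>z\<in>V. y + z \<in> V) \<and> (\<forall>f\<in>convergent_fps. \<forall>y\<in>V. f * y \<in> V) \<and>
     (\<forall>y\<in>V. x_sigma_q q y \<in> V) \<and> (\<forall>y\<in>V. generic_q_Gevrey q y)"

text \<open>An element \<open>v + f * G\<close> with \<open>f \<noteq> 0\<close> can be divided by the unit part of \<open>f\<close>, after which the
  coefficient of \<open>G\<close> is a pure power \<open>x ^ N\<close>. The first-order operator with eigenvalue
  \<open>a * q ^ N\<close> then eliminates \<open>G\<close> and leads back to \<open>V\<close>, whose elements are generic. A zero of
  \<open>f\<close> at the origin thus merely shifts the eigenvalue.\<close>

lemma generic_module_extend:
  assumes "q > 1" "a \<noteq> 0" "generic_module q V" "x_sigma_q_minus q a G \<in> V"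
  shows "generic_module q {v + f * G | v f. v \<in> V \<and> f \<in> convergent_fps}" (is "generic_module q ?W")
proof -
  note V = assms(3)[unfolded generic_module_def]
  have conv: "f \<in> V" if "f \<in> convergent_fps" for f
    using V that by blast
  have add: "y + z \<in> V" if "y \<in> V" "z \<in> V" for y z
    using V that by blast
  have mult: "f * y \<in> V" if "f \<in> convergent_fps" "y \<in> V" for f y
    using V that by blast
  have shift: "x_sigma_q q y \<in> V" if "y \<in> V" for y
    using V that by blast
  have gen: "generic_q_Gevrey q y" if "y \<in> V" for y
    using V that by blast
  have W: "v + f * G \<in> ?W" if "v \<in> V" "f \<in> convergent_fps" for v f
    using that by blast
  have gW: "generic_q_Gevrey q (v + f * G)" if v: "v \<in> V" and f: "f \<in> convergent_fps" for v f
  proof (cases "f = 0")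
    case True
    thus ?thesis using gen[OF v] by simp
  next
    case False
    define N where "N = subdegree f"
    define u where "u = fps_shift N f"
    have f_eq: "f = u * fps_X ^ N"
      unfolding u_def N_def by (rule subdegree_decompose)
    have u0: "fps_nth u 0 \<noteq> 0"
      using False by (simp add: u_def N_def)
    have uc: "u \<in> convergent_fps"
      using f by (simp add: u_def convergent_fps_def)
    define i where "i = inverse u"
    have i: "i \<in> convergent_fps" "fps_nth i 0 \<noteq> 0" "i * u = 1"
      using uc u0 by (auto simp: i_def inverse_mult_eq_1)
    \<comment> \<open>The eigenvalue of \<open>x ^ N * G\<close>.\<close>
  define c where "c = a * of_real q ^ N"
    have "i * (v + f * G) = i * v + (i * u) * (fps_X ^ N * G)"
      unfolding f_eq by (simp only: algebra_simps)
    hence "i * (v + f * G) = i * v + fps_X ^ N * G"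
      unfolding i(3) by simp
    hence "x_sigma_q_minus q c (i * (v + f * G)) =
        x_sigma_q q (i * v) + fps_const (- c) * (i * v) +
          fps_const (of_real q ^ N) * fps_X ^ N * x_sigma_q_minus q a G"
      unfolding c_def by (simp only: x_sigma_q_minus_add x_sigma_q_minus_X_power_mult)
        (simp add: x_sigma_q_minus_def flip: fps_const_neg)
    also have "\<dots> \<in> V"
      using i(1) v assms(4) by (intro add mult shift convergent_fps_mult) auto
    finally have "generic_q_Gevrey q (x_sigma_q_minus q c (i * (v + f * G)))"
      by (rule gen)
    moreover have "c \<noteq> 0"
      using assms(1,2) by (simp add: c_def)
    ultimately show ?thesis
      using generic_q_Gevrey_if_x_sigma_q_minus[OF assms(1) _ i(1,2)] by blast
  qed
  have cW: "f \<in> ?W" if "f \<in> convergent_fps" for f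
    using W[OF conv[OF that] convergent_fps_0] by simp
  have aW: "(v + f * G) + (v' + f' * G) \<in> ?W"
    if "v \<in> V" "f \<in> convergent_fps" "v' \<in> V" "f' \<in> convergent_fps" for v f v' f'
    using W[OF add[OF that(1,3)] convergent_fps_add[OF that(2,4)]] by (simp only: algebra_simps)
  have mW: "g * (v + f * G) \<in> ?W"
    if "g \<in> convergent_fps" "v \<in> V" "f \<in> convergent_fps" for g v f
    using W[OF mult[OF that(1,2)] convergent_fps_mult[OF that(1,3)]] by (simp only: algebra_simps)
  have sW: "x_sigma_q q (v + f * G) \<in> ?W" if "v \<in> V" "f \<in> convergent_fps" for v f
  proof -
    have "x_sigma_q q (v + f * G) = (x_sigma_q q v + sigma_q q f * x_sigma_q_minus q a G) +
        (fps_const a * sigma_q q f) * G"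
      unfolding x_sigma_q_add x_sigma_q_mult x_sigma_q_minus_def by algebra
    moreover have "sigma_q q f \<in> convergent_fps"
      using assms(1) that(2) by (rule convergent_fps_sigma_q)
    ultimately show ?thesis
      using W[OF add[OF shift[OF that(1)] mult[OF _ assms(4)]] convergent_fps_mult[OF convergent_fps_const]]
      by simp
  qed
  have W_cases: "P y" if "y \<in> ?W" "\<And>v f. v \<in> V \<Longrightarrow> f \<in> convergent_fps \<Longrightarrow> P (v + f * G)" for P y
    using that by blast
  show ?thesis
    unfolding generic_module_def
  proof (intro conjI ballI subsetI)
    fix y z assume y: "y \<in> ?W" and z: "z \<in> ?W"
    from y show "y + z \<in> ?W"
    proof (rule W_cases)
      fix v f assume v: "v \<in> V" "f \<in> convergent_fps"
      from z show "(v + f * G) + z \<in> ?W"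
        by (rule W_cases) (rule aW[OF v])
    qed
  next
    fix g y assume g: "g \<in> convergent_fps" and y: "y \<in> ?W"
    from y show "g * y \<in> ?W"
      by (rule W_cases) (rule mW[OF g])
  next
    fix y assume y: "y \<in> ?W"
    from y show "x_sigma_q q y \<in> ?W"
      by (rule W_cases) (rule sW)
    from y show "generic_q_Gevrey q y"
      by (rule W_cases) (rule gW)
  qed (rule cW)
qed

text \<open>The Jordan chain of \<open>a\<close> is adjoined from its bottom upwards, so that at each stage the
  first-order operator maps the new generator into the module already constructed.\<close>

lemma generic_module_contains_q_Euler_gen:
  assumes "q > 1" "a \<noteq> 0" "generic_module q V"
  shows "\<exists>W. generic_module q W \<and> V \<subseteq> W \<and> q_Euler_gen q a \<alpha> \<in> W"
proof (induction \<alpha>)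
  have ext: "\<exists>W. generic_module q W \<and> U \<subseteq> W \<and> G \<in> W"
    if "generic_module q U" "x_sigma_q_minus q a G \<in> U" for U G
  proof -
    let ?W = "{v + f * G | v f. v \<in> U \<and> f \<in> convergent_fps}"
    have "0 \<in> U"
      using that(1) convergent_fps_0 unfolding generic_module_def by blast
    hence "0 + 1 * G \<in> ?W" by blast
    hence "G \<in> ?W" by (simp only: mult_1_left add_0_left)
    moreover have "U \<subseteq> ?W"
    proof
      fix v assume "v \<in> U"
      hence "v + 0 * G \<in> ?W" by blast
      thus "v \<in> ?W" by (simp only: mult_zero_left add_0_right)
    qed
    ultimately show ?thesis
      using generic_module_extend[OF assms(1,2) that] by (intro exI[of _ ?W] conjI)
  qed
  case 0
  have "1 \<in> V"
    using assms(3) convergent_fps_1 unfolding generic_module_def by blast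
  thus ?case
    by (intro ext[OF assms(3)]) (simp only: x_sigma_q_minus_q_Euler_gen_0[OF assms(2)])
  case (Suc \<alpha>)
  then obtain U where U: "generic_module q U" "V \<subseteq> U" "q_Euler_gen q a \<alpha> \<in> U" by blast
  from U(3) have "x_sigma_q_minus q a (q_Euler_gen q a (Suc \<alpha>)) \<in> U"
    by (simp only: x_sigma_q_minus_q_Euler_gen_Suc[OF assms(2)])
  from ext[OF U(1) this] U(2) show ?case by blast
qed

lemma generic_module_convergent:
  assumes "q > 1"
  shows "generic_module q convergent_fps"
  unfolding generic_module_def
  by (intro conjI ballI subset_refl convergent_fps_add convergent_fps_mult
      convergent_fps_x_sigma_q[OF assms] generic_q_Gevrey_convergent)

lemma generic_q_Gevrey_if_Euler_span:
  assumes "q > 1" "y \<in> Euler_span q"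
  shows "generic_q_Gevrey q y"
proof -
  have "\<exists>V. generic_module q V \<and> y \<in> V"
    using assms(2)
  proof induction
    case (convergent f)
    thus ?case using generic_module_convergent[OF assms(1)] by blast
  next
    case (add_Euler y f a \<alpha>)
    then obtain V where V: "generic_module q V" "y \<in> V" by blast
    obtain W where W: "generic_module q W" "V \<subseteq> W" "q_Euler_gen q a \<alpha> \<in> W"
      using generic_module_contains_q_Euler_gen[OF assms(1) add_Euler.hyps(3) V(1)] by blast
    have "f * q_Euler_gen q a \<alpha> \<in> W"
      using W(1,3) add_Euler.hyps(2) unfolding generic_module_def by simp
    hence "y + f * q_Euler_gen q a \<alpha> \<in> W"
      using W(1,2) V(2) unfolding generic_module_def by (simp add: subset_iff)
    with W(1) show ?case by blast
  qed
  then obtain V where "generic_module q V" "y \<in> V" by blast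
  thus ?thesis unfolding generic_module_def by blast
qed

section \<open>Factoring a generic operator\<close>

text \<open>A root of maximal modulus will do: the numbers \<open>c * q ^ m\<close> have larger modulus.\<close>

lemma nonresonant_root:
  fixes b :: "nat \<Rightarrow> complex"
  assumes "q > 1" "n > 0" "b 0 \<noteq> 0" "b n \<noteq> 0"
  obtains c where "c \<noteq> 0" "(\<Sum>k\<le>n. b k * c ^ k) = 0"
    "\<And>m. m > 0 \<Longrightarrow> (\<Sum>k\<le>n. b k * (c * of_real q ^ m) ^ k) \<noteq> 0"
proof -
  define P where "P = (\<Sum>k\<le>n. monom (b k) k)"
  have poly_P: "poly P x = (\<Sum>k\<le>n. b k * x ^ k)" for x
    by (simp add: P_def poly_sum poly_monom)
  have coeff_P: "coeff P k = b k" if "k \<le> n" for k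
    using that by (simp add: P_def coeff_sum)
  have P0: "P \<noteq> 0"
    using coeff_P[of 0] assms(3) by auto
  have "degree P \<noteq> 0"
    using le_degree[of P n] coeff_P[of n] assms(2,4) by simp
  hence "\<not> constant (poly P)"
    by (simp add: constant_degree)
  then obtain z where "poly P z = 0"
    using fundamental_theorem_of_algebra by blast
  hence ne: "norm ` {x. poly P x = 0} \<noteq> {}" by blast
  have fin: "finite (norm ` {x. poly P x = 0})"
    using poly_roots_finite[OF P0] by simp
  obtain c where c: "poly P c = 0" "norm c = Max (norm ` {x. poly P x = 0})"
    using Max_in[OF fin ne] by auto
  have c0: "c \<noteq> 0"
  proof
    assume "c = 0"
    hence "coeff P 0 = 0" using c(1) by (simp add: poly_0_coeff_0)
    thus False using coeff_P[of 0] assms(3) by simp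
  qed
  have "poly P (c * of_real q ^ m) \<noteq> 0" if "m > 0" for m
  proof
    assume "poly P (c * of_real q ^ m) = 0"
    hence "norm (c * of_real q ^ m) \<le> norm c"
      unfolding c(2) using fin by (intro Max_ge) auto
    moreover have "q ^ m > 1"
      using assms(1) that by (simp add: one_less_power)
    ultimately show False
      using c0 assms(1) by (simp add: norm_mult norm_power)
  qed
  with c(1) show thesis
    unfolding poly_P by (rule that[OF c0])
qed

fun recurrent_seq :: "(nat \<Rightarrow> nat \<Rightarrow> complex) \<Rightarrow> nat \<Rightarrow> complex" where
  "recurrent_seq W n = (if n = 0 then 1 else (\<Sum>j<n. W n j * recurrent_seq W j))"

declare recurrent_seq.simps [simp del]

text \<open>The induction closes because of \<open>K * (\<Sum>j<n. (1 + K) ^ j) = (1 + K) ^ n - 1\<close>.\<close>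

lemma norm_recurrent_seq_le:
  assumes "K \<ge> 0" "R \<ge> 0" "\<And>n j. j < n \<Longrightarrow> norm (W n j) \<le> K * R ^ (n - j)"
  shows "norm (recurrent_seq W n) \<le> (R * (1 + K)) ^ n"
proof (induction n rule: less_induct)
  case (less n)
  show ?case
  proof (cases "n = 0")
    case True
    thus ?thesis by (simp add: recurrent_seq.simps)
  next
    case False
    hence "norm (recurrent_seq W n) \<le> (\<Sum>j<n. norm (W n j * recurrent_seq W j))"
      by (subst recurrent_seq.simps) (simp add: norm_sum)
    also have "\<dots> \<le> (\<Sum>j<n. R ^ n * (K * (1 + K) ^ j))"
    proof (rule sum_mono)
      fix j assume j: "j \<in> {..<n}"
      hence "norm (W n j * recurrent_seq W j) \<le> (K * R ^ (n - j)) * (R * (1 + K)) ^ j"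
        unfolding norm_mult using assms less.IH by (intro mult_mono) auto
      also have "\<dots> = (R ^ (n - j) * R ^ j) * (K * (1 + K) ^ j)"
        by (simp add: power_mult_distrib)
      also have "R ^ (n - j) * R ^ j = R ^ n"
        using j by (simp flip: power_add)
      finally show "norm (W n j * recurrent_seq W j) \<le> R ^ n * (K * (1 + K) ^ j)" .
    qed
    also have "\<dots> = R ^ n * (K * (\<Sum>j<n. (1 + K) ^ j))"
      by (simp add: sum_distrib_left)
    also have "K * (\<Sum>j<n. (1 + K) ^ j) = (1 + K) ^ n - 1"
      using power_diff_1_eq[of "1 + K" n] by simp
    also have "R ^ n * ((1 + K) ^ n - 1) \<le> (R * (1 + K)) ^ n"
      using assms(2) by (simp add: power_mult_distrib right_diff_distrib)
    finally show ?thesis .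
  qed
qed

text \<open>In effect, \<open>u * e\<close> solves the homogeneous equation, where \<open>e\<close> is a symbol with \<open>x \<sigma> e = c * e\<close>.
  Let \<open>P m\<close> be the characteristic polynomial at \<open>c * q ^ m\<close>. The coefficient \<open>u\<^sub>m\<close> is determined
  by dividing by \<open>P m\<close> a combination of the previous coefficients with weights \<open>A m j\<close>. The weights
  are bounded by \<open>q ^ (m * n)\<close> times \<open>R ^ (m - j)\<close> for some \<open>R\<close>, up to a constant factor; since the leading coefficient of the operator does not vanish at
  \<open>0\<close>, the divisor \<open>P m\<close> grows exactly at that rate, and \<open>u\<close> converges.\<close>

lemma exists_convergent_gauge:
  assumes q: "q > 1" and conv: "\<And>k. k \<le> n \<Longrightarrow> b k \<in> convergent_fps"
    and bn: "fps_nth (b n) 0 \<noteq> 0" and c: "c \<noteq> 0"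
    and root: "(\<Sum>k\<le>n. fps_nth (b k) 0 * c ^ k) = 0"
    and nonroot: "\<And>m. m > 0 \<Longrightarrow> (\<Sum>k\<le>n. fps_nth (b k) 0 * (c * of_real q ^ m) ^ k) \<noteq> 0"
  obtains u where "u \<in> convergent_fps" "fps_nth u 0 = 1"
    "(\<Sum>k\<le>n. fps_const (c ^ k) * b k * (sigma_q q ^^ k) u) = 0"
proof -
  define P where "P m = (\<Sum>k\<le>n. fps_nth (b k) 0 * (c * of_real q ^ m) ^ k)" for m
  define A where "A m j = (\<Sum>k\<le>n. c ^ k * fps_nth (b k) (m - j) * of_real q ^ (k * j))" for m j
  define W where "W m j = - A m j / P m" for m j
  define u where "u = Abs_fps (recurrent_seq W)"
  have u_nth: "fps_nth u m = (if m = 0 then 1 else (\<Sum>j<m. W m j * fps_nth u j))" for m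
    unfolding u_def fps_nth_Abs_fps by (rule recurrent_seq.simps)

  have "(\<Sum>k\<le>n. fps_const (c ^ k) * b k * (sigma_q q ^^ k) u) = 0"
  proof (rule fps_ext)
    fix m
    have "fps_nth (\<Sum>k\<le>n. fps_const (c ^ k) * b k * (sigma_q q ^^ k) u) m =
        (\<Sum>k\<le>n. \<Sum>j\<le>m. c ^ k * fps_nth (b k) (m - j) * (of_real q ^ (k * j) * fps_nth u j))"
    proof -
      have "fps_nth (fps_const (c ^ k) * b k * (sigma_q q ^^ k) u) m =
          (\<Sum>j\<le>m. c ^ k * fps_nth (b k) (m - j) * (of_real q ^ (k * j) * fps_nth u j))" for k
      proof -
        have "fps_nth (fps_const (c ^ k) * b k * (sigma_q q ^^ k) u) m =
            fps_nth (fps_const (c ^ k) * ((sigma_q q ^^ k) u * b k)) m"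
          by (simp only: mult_ac)
        also have "\<dots> = c ^ k * (\<Sum>j\<le>m. of_real q ^ (k * j) * fps_nth u j * fps_nth (b k) (m - j))"
          unfolding fps_mult_left_const_nth by (simp only: fps_mult_nth atLeast0AtMost sigma_q_funpow_nth)
        finally show ?thesis
          by (simp add: sum_distrib_left mult_ac)
      qed
      thus ?thesis by (simp add: fps_sum_nth)
    qed
    also have "\<dots> = (\<Sum>j\<le>m. A m j * fps_nth u j)"
      unfolding A_def sum_distrib_right by (subst sum.swap) (simp add: mult_ac)
    also have "\<dots> = A m m * fps_nth u m + (\<Sum>j<m. A m j * fps_nth u j)"
      by (simp flip: lessThan_Suc_atMost)
    also have "A m m = P m"
      unfolding A_def P_def
      by (intro sum.cong) (simp_all add: power_mult_distrib power_mult[symmetric] mult_ac)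
    also have "P m * fps_nth u m + (\<Sum>j<m. A m j * fps_nth u j) = 0"
    proof (cases "m = 0")
      case True
      thus ?thesis using root by (simp add: P_def)
    next
      case False
      have "P m * (\<Sum>j<m. W m j * fps_nth u j) = (\<Sum>j<m. - (A m j * fps_nth u j))"
        unfolding sum_distrib_left using nonroot[of m] False
        by (intro sum.cong) (simp_all add: W_def P_def[symmetric])
      with False show ?thesis
        by (subst u_nth) (simp add: sum_negf)
    qed
    finally show "fps_nth (\<Sum>k\<le>n. fps_const (c ^ k) * b k * (sigma_q q ^^ k) u) m = fps_nth 0 m"
      by simp
  qed

  moreover have "u \<in> convergent_fps"
  proof -
    \<comment> \<open>The quotient \<open>P m / q ^ (m * n)\<close> tends to the leading coefficient of \<open>P\<close> times \<open>c ^ n\<close>.\<close>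
    have "(\<lambda>m. inverse (of_real q) ^ m :: complex) \<longlonglongrightarrow> 0"
      using q by (intro LIMSEQ_power_zero) (simp add: norm_inverse inverse_less_1_iff)
    hence "(\<lambda>m. \<Sum>k\<le>n. fps_nth (b k) 0 * c ^ k * (inverse (of_real q) ^ m) ^ (n - k))
        \<longlonglongrightarrow> (\<Sum>k\<le>n. fps_nth (b k) 0 * c ^ k * 0 ^ (n - k))"
      by (intro tendsto_sum tendsto_mult tendsto_const tendsto_power)
    also have "(\<Sum>k\<le>n. fps_nth (b k) 0 * c ^ k * 0 ^ (n - k)) = fps_nth (b n) 0 * c ^ n"
      by (subst sum.remove[of _ n]) (auto intro!: sum.neutral)
    also have "(\<lambda>m. \<Sum>k\<le>n. fps_nth (b k) 0 * c ^ k * (inverse (of_real q) ^ m) ^ (n - k)) =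
        (\<lambda>m. P m / of_real q ^ (m * n))"
    proof
      fix m
      have "complex_of_real (inverse q ^ m) ^ (n - k) = of_real (q ^ m) ^ k / of_real q ^ (m * n)"
        if "k \<le> n" for k
        using q that by (simp add: power_mult power_diff field_simps)
      thus "(\<Sum>k\<le>n. fps_nth (b k) 0 * c ^ k * (inverse (of_real q) ^ m) ^ (n - k)) =
          P m / of_real q ^ (m * n)"
        unfolding P_def sum_divide_distrib
        by (intro sum.cong) (simp_all add: power_mult_distrib)
    qed
    finally have "(\<lambda>m. inverse (P m / of_real q ^ (m * n))) \<longlonglongrightarrow> inverse (fps_nth (b n) 0 * c ^ n)"
      using bn c by (intro tendsto_inverse) auto
    hence "Bseq (\<lambda>m. inverse (P m / of_real q ^ (m * n)))"
      by (intro convergent_imp_Bseq convergentI)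
    then obtain K where K: "K > 0" "\<And>m. norm (inverse (P m / of_real q ^ (m * n))) \<le> K"
      by (auto simp: Bseq_def)
    \<comment> \<open>Summing the absolute values of the coefficients gives bounds common to all \<open>b k\<close>.\<close>
    have "(\<Sum>k\<le>n. Abs_fps (\<lambda>m. complex_of_real (norm (fps_nth (b k) m)))) \<in> convergent_fps"
    proof (rule convergent_fps_sum)
      fix k assume "k \<in> {..n}"
      hence "b k \<in> convergent_fps" by (simp add: conv)
      thus "Abs_fps (\<lambda>m. complex_of_real (norm (fps_nth (b k) m))) \<in> convergent_fps"
        by (rule convergent_fpsI[where K = 1 and R = 1]) auto
    qed
    then obtain C R where CR: "C > 0" "R > 0"
      "\<And>m. norm (fps_nth (\<Sum>k\<le>n. Abs_fps (\<lambda>m. complex_of_real (norm (fps_nth (b k) m)))) m) \<le> C * R ^ m"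
      unfolding convergent_fps_iff_geometric_bound by blast
    have b_bound: "norm (fps_nth (b k) m) \<le> C * R ^ m" if "k \<le> n" for k m
    proof -
      have "norm (fps_nth (b k) m) \<le> (\<Sum>k\<le>n. norm (fps_nth (b k) m))"
        using that by (intro member_le_sum) auto
      also have "\<dots> = norm (complex_of_real (\<Sum>k\<le>n. norm (fps_nth (b k) m)))"
        by (simp add: sum_nonneg del: of_real_sum)
      also have "\<dots> \<le> C * R ^ m"
        using CR(3)[of m] by (simp add: fps_sum_nth)
      finally show ?thesis .
    qed
    define D where "D = (\<Sum>k\<le>n. norm c ^ k)"
    have D: "D \<ge> 0" unfolding D_def by (intro sum_nonneg) auto
    have "norm (W m j) \<le> (K * C * D) * R ^ (m - j)" if "j < m" for m j
    proof -
      have "norm (A m j) \<le> (\<Sum>k\<le>n. norm c ^ k * (C * R ^ (m - j)) * q ^ (m * n))"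
        unfolding A_def
      proof (rule sum_norm_le)
        fix k assume k: "k \<in> {..n}"
        have kj: "k * j \<le> m * n"
          using k that mult_le_mono[of k n j m] by (simp add: mult.commute)
        from k have "norm c ^ k * norm (fps_nth (b k) (m - j)) * q ^ (k * j) \<le>
            norm c ^ k * (C * R ^ (m - j)) * q ^ (m * n)"
          using b_bound CR q kj
          by (intro mult_mono[OF mult_left_mono power_increasing]) auto
        thus "norm (c ^ k * fps_nth (b k) (m - j) * of_real q ^ (k * j)) \<le>
            norm c ^ k * (C * R ^ (m - j)) * q ^ (m * n)"
          using q by (simp add: norm_mult norm_power)
      qed
      also have "\<dots> = (C * D * R ^ (m - j)) * q ^ (m * n)"
        by (simp add: D_def sum_distrib_left sum_distrib_right mult_ac)
      finally have A: "norm (A m j) \<le> (C * D * R ^ (m - j)) * q ^ (m * n)" .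
      have "norm (W m j) = norm (A m j) / q ^ (m * n) * norm (inverse (P m / of_real q ^ (m * n)))"
        using q by (simp add: W_def norm_divide norm_inverse norm_power field_simps)
      also have "\<dots> \<le> (C * D * R ^ (m - j)) * K"
        using A K q D CR by (intro mult_mono) (auto simp: field_simps)
      finally show ?thesis by (simp add: mult_ac)
    qed
    hence "norm (fps_nth u m) \<le> 1 * (R * (1 + K * C * D)) ^ m" for m
      unfolding u_def fps_nth_Abs_fps mult_1_left
      using K CR D by (intro norm_recurrent_seq_le) auto
    moreover have "R * (1 + K * C * D) > 0"
      using K CR D by (intro mult_pos_pos add_pos_nonneg) auto
    ultimately show ?thesis
      unfolding convergent_fps_iff_geometric_bound using zero_less_one by blast
  qed
  moreover have "fps_nth u 0 = 1"
    by (subst u_nth) simp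
  ultimately show thesis using that by blast
qed

text \<open>Right division by \<open>x \<sigma> - c\<close>. The constant \<open>c\<close> commutes with the shift, so the quotient is
  computed as for ordinary polynomials, from the geometric sum for the difference of the \<open>k\<close>-th
  powers of the shift and of \<open>c\<close>; the remainder is the value of the symbol at \<open>c\<close>.\<close>

lemma diff_op_right_division:
  assumes "(\<Sum>k\<le>Suc n. fps_const (c ^ k) * d k) = 0"
  shows "diff_op q (Suc n) d w =
    diff_op q n (\<lambda>j. \<Sum>k\<in>{j<..Suc n}. fps_const (c ^ (k - 1 - j)) * d k) (x_sigma_q_minus q c w)"
proof -
  define T where "T k = (x_sigma_q q ^^ k) w" for k
  define S where "S j = (x_sigma_q q ^^ j) (x_sigma_q_minus q c w)" for j
  have S: "S j = T (Suc j) - fps_const c * T j" for j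
    unfolding S_def T_def x_sigma_q_minus_def x_sigma_q_funpow_diff x_sigma_q_funpow_const_mult
      funpow_Suc_right o_apply ..
  have T: "T k = fps_const (c ^ k) * w + (\<Sum>j<k. fps_const (c ^ (k - 1 - j)) * S j)" for k
  proof (induction k)
    case 0
    show ?case by (simp add: T_def)
  next
    case (Suc k)
    have "(\<Sum>j<k. fps_const (c ^ (k - j)) * S j) =
        fps_const c * (\<Sum>j<k. fps_const (c ^ (k - 1 - j)) * S j)"
      unfolding sum_distrib_left
    proof (rule sum.cong[OF refl])
      fix j assume "j \<in> {..<k}"
      hence "k - j = Suc (k - 1 - j)" by auto
      thus "fps_const (c ^ (k - j)) * S j = fps_const c * (fps_const (c ^ (k - 1 - j)) * S j)"
        by (simp add: mult.assoc[symmetric])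
    qed
    moreover have "T (Suc k) = fps_const c * T k + S k"
      by (simp add: S)
    ultimately show ?case
      unfolding Suc by (simp add: distrib_left mult.assoc[symmetric] add.assoc)
  qed
  have "diff_op q (Suc n) d w = (\<Sum>k\<le>Suc n. d k * T k)"
    by (simp only: diff_op_def T_def)
  also have "\<dots> = (\<Sum>k\<le>Suc n. fps_const (c ^ k) * d k) * w +
      (\<Sum>k\<le>Suc n. \<Sum>j<k. fps_const (c ^ (k - 1 - j)) * d k * S j)"
    unfolding sum_distrib_right sum.distrib[symmetric]
    by (subst T) (simp only: distrib_left sum_distrib_left mult_ac)
  also have "(\<Sum>k\<le>Suc n. \<Sum>j<k. fps_const (c ^ (k - 1 - j)) * d k * S j) =
      (\<Sum>j\<le>n. \<Sum>k\<in>{j<..Suc n}. fps_const (c ^ (k - 1 - j)) * d k * S j)"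
    by (subst sum.Sigma, simp, simp, subst sum.Sigma, simp, simp,
        rule sum.reindex_bij_witness[of _ "\<lambda>(j, k). (k, j)" "\<lambda>(k, j). (j, k)"]) auto
  also have "\<dots> = diff_op q n (\<lambda>j. \<Sum>k\<in>{j<..Suc n}. fps_const (c ^ (k - 1 - j)) * d k) (x_sigma_q_minus q c w)"
    by (simp only: diff_op_def S_def sum_distrib_right)
  finally show ?thesis using assms by simp
qed

text \<open>Writing \<open>y = u * w\<close> with the unit \<open>u\<close> from the preceding construction turns the operator into one that is divisible on
  the right by \<open>x \<sigma> - c\<close>. The quotient has lower order and is nondegenerate: its leading
  coefficient at \<open>0\<close> is unchanged, and its lowest one at \<open>0\<close> is that of the given operator divided
  by \<open>- c\<close>. By induction \<open>(x \<sigma> - c) w\<close> lies in the span, and the inversion of \<open>x \<sigma> - c\<close> on the span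
  brings \<open>w\<close> there too.\<close>

lemma Euler_span_if_diff_op:
  assumes q: "q > 1" and "nondegenerate n b" "diff_op q n b y \<in> Euler_span q"
  shows "y \<in> Euler_span q"
  using assms(2,3)
proof (induction n arbitrary: b y)
  case (0 b y)
  hence b: "b 0 \<in> convergent_fps" "fps_nth (b 0) 0 \<noteq> 0"
    by (auto simp: nondegenerate_def)
  have "inverse (b 0) * (b 0 * y) \<in> Euler_span q"
    using 0(2) by (intro Euler_span_mult[OF convergent_fps_inverse[OF b]]) (simp add: diff_op_def)
  thus ?case
    by (simp only: mult.assoc[symmetric] inverse_mult_eq_1[OF b(2)] mult_1_left)
next
  case (Suc n b y)
  have conv: "b k \<in> convergent_fps" if "k \<le> Suc n" for k
    using Suc.prems(1) that by (simp add: nondegenerate_def)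
  have b0: "fps_nth (b 0) 0 \<noteq> 0" and bn: "fps_nth (b (Suc n)) 0 \<noteq> 0"
    using Suc.prems(1) by (auto simp: nondegenerate_def)
  obtain c where c: "c \<noteq> 0" "(\<Sum>k\<le>Suc n. fps_nth (b k) 0 * c ^ k) = 0"
    "\<And>m. m > 0 \<Longrightarrow> (\<Sum>k\<le>Suc n. fps_nth (b k) 0 * (c * of_real q ^ m) ^ k) \<noteq> 0"
    using nonresonant_root[of q "Suc n" "\<lambda>k. fps_nth (b k) 0", OF q _ b0 bn] by blast
  obtain u where u: "u \<in> convergent_fps" "fps_nth u 0 = 1"
    "(\<Sum>k\<le>Suc n. fps_const (c ^ k) * b k * (sigma_q q ^^ k) u) = 0"
    using exists_convergent_gauge[OF q conv bn c] by blast
  define w where "w = inverse u * y"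
  have y: "y = u * w"
    using u(2) by (simp add: w_def mult.assoc[symmetric] inverse_mult_eq_1')
  define d where "d k = b k * (sigma_q q ^^ k) u" for k
  define e where "e j = (\<Sum>k\<in>{j<..Suc n}. fps_const (c ^ (k - 1 - j)) * d k)" for j
  have d0: "fps_nth (d k) 0 = fps_nth (b k) 0" for k
    by (simp add: d_def u(2))
  have d_sum: "(\<Sum>k\<le>Suc n. fps_const (c ^ k) * d k) = 0"
    using u(3) by (simp only: d_def mult.assoc)
  have "diff_op q (Suc n) b y = diff_op q (Suc n) d w"
    by (simp only: diff_op_def y x_sigma_q_funpow_mult d_def mult.assoc)
  also have "\<dots> = diff_op q n e (x_sigma_q_minus q c w)"
    unfolding e_def by (rule diff_op_right_division[OF d_sum])
  finally have "diff_op q n e (x_sigma_q_minus q c w) \<in> Euler_span q"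
    using Suc.prems(2) by simp
  moreover have "nondegenerate n e"
    unfolding nondegenerate_def
  proof (intro conjI allI impI)
    show "e k \<in> convergent_fps" for k
      unfolding e_def d_def using conv u(1) q
      by (intro convergent_fps_sum convergent_fps_mult convergent_fps_sigma_q_funpow) auto
    have "{n<..Suc n} = {Suc n}" by auto
    thus "fps_nth (e n) 0 \<noteq> 0"
      using bn by (simp add: e_def d0)
    have "{..Suc n} = insert 0 {0<..Suc n}" by auto
    hence "0 = fps_nth (b 0) 0 + (\<Sum>k\<in>{0<..Suc n}. fps_nth (b k) 0 * c ^ k)"
      using c(2) by simp
    also have "(\<Sum>k\<in>{0<..Suc n}. fps_nth (b k) 0 * c ^ k) =
        c * (\<Sum>k\<in>{0<..Suc n}. c ^ (k - 1) * fps_nth (b k) 0)"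
      unfolding sum_distrib_left
    proof (rule sum.cong[OF refl])
      fix k assume "k \<in> {0<..Suc n}"
      hence "c ^ k = c * c ^ (k - 1)" by (cases k) auto
      thus "fps_nth (b k) 0 * c ^ k = c * (c ^ (k - 1) * fps_nth (b k) 0)" by simp
    qed
    also have "(\<Sum>k\<in>{0<..Suc n}. c ^ (k - 1) * fps_nth (b k) 0) = fps_nth (e 0) 0"
      by (simp add: e_def fps_sum_nth d0)
    finally show "fps_nth (e 0) 0 \<noteq> 0"
      using b0 by auto
  qed
  ultimately have "x_sigma_q_minus q c w \<in> Euler_span q"
    using Suc.IH by blast
  hence "w \<in> Euler_span q"
    by (rule Euler_span_if_x_sigma_q_minus[OF q c(1)])
  thus ?case
    unfolding y by (rule Euler_span_mult[OF u(1)])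
qed

theorem theorem2p5:
  fixes q :: real and fhat :: "complex fps"
  assumes "q > 1"
  shows "generic_q_Gevrey q fhat \<longleftrightarrow>
    (\<exists>(m::nat) (f :: nat \<Rightarrow> complex fps) (a :: nat \<Rightarrow> complex) (\<alpha> :: nat \<Rightarrow> nat).
       (\<forall>i\<in>{0..m}. f i \<in> convergent_fps) \<and>
       (\<forall>i\<in>{1..m}. a i \<noteq> 0) \<and>
       fhat = f 0 + (\<Sum>i=1..m. f i * q_Euler_gen q (a i) (\<alpha> i)))"
  unfolding Euler_span_iff[symmetric]
proof
  assume "generic_q_Gevrey q fhat"
  then obtain n b where "nondegenerate n b" "diff_op q n b fhat \<in> convergent_fps"
    unfolding generic_q_Gevrey_iff by blast
  thus "fhat \<in> Euler_span q"
    using Euler_span_if_diff_op[OF assms] Euler_span.convergent by blast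
next
  assume "fhat \<in> Euler_span q"
  thus "generic_q_Gevrey q fhat"
    by (rule generic_q_Gevrey_if_Euler_span[OF assms])
qed

end
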